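(* Let $p\ge1$ be an integer and $q\ge2$. Let $f=g+h$ on $\mathbb{R}^n$, with $g,h$ proper closed convex, $h$ possibly nonsmooth, $g$ $p$-times continuously differentiable with $\|D^pg(x)-D^pg(y)\|\le L_{p+1}(g)\|x-y\|$ for all $x,y\in\mathbb{R}^n$ ($L_{p+1}(g)>0$), and suppose $f$ has a minimizer $x^*$ and is uniformly convex of degree $q$ with parameter $\sigma_q(f)>0$, i.e. $f(x)\ge f(y)+\langle g_y,x-y\rangle+\frac{\sigma_q(f)}{q}\|x-y\|^q$ for all $x,y\in\mathbb{R}^n$ and all $g_y\in\partial f(y)$. Let $x_0\in\mathbb{R}^n$, $\nu_0\in\partial f(x_0)$ and $\varepsilon>0$ with $\|\nu_0\|\ge\varepsilon$. Then the restarted high-order AR method (see context) computes a point $\widehat{x}$ such that there exists $\widehat{\nu}\in\partial f(\widehat{x})$ with $\|\widehat{\nu}\|\le\varepsilon$: (i) if $q=p+1$, within at most $$\mathcal{O}\left(\Big[\tfrac{(p+1)L_{p+1}(g)}{\sigma_q(f)}\Big]^{\frac{2}{3p+1}}\log\tfrac{\|\nu_0\|}{\varepsilon}\right)$$ calls to the $p$-th-order oracle; (ii) if $q>p+1$, within at most $$\mathcal{O}\left(\Big[\tfrac{qL_{p+1}(g)}{\sigma_q(f)}\Big]^{\frac{2}{3p+1}}\Big(\tfrac{q}{\sigma_q(f)}\Big)^{\frac{2(q-1-p)}{(3p+1)(q-1)}}\Big(\tfrac1\varepsilon\Big)^{\frac{2(q-1-p)}{(3p+1)(q-1)}}\right)$$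 calls to the $p$-th-order oracle; (iii) if $q<p+1$, within at most $$\mathcal{O}\left(\tfrac{1}{\log(\frac{p}{q-1})}\log\log\Big[\tfrac{\sigma_q(f)}{q\varepsilon}\Big(\tfrac{\sigma_q(f)}{qL_{p+1}(g)}\Big)^{\frac{q-1}{p+1-q}}\Big]+\Big(\tfrac{qL_{p+1}(g)}{\sigma_q(f)}\Big)^{\frac{2}{3p+1}}\Big(\tfrac{q\|\nu_0\|}{\sigma_q(f)}\Big)^{\frac{2(p-q+1)}{(3p+1)(q-1)}}\right)$$ calls to the $p$-th-order oracle.
   Context: $\|\cdot\|$ is the Euclidean norm; for symmetric $p$-linear forms it is the induced norm. $\partial$ is the convex subdifferential. The $p$-th-order oracle at $x$ returns the function value and all derivatives up to order $p$ (of the smooth part); each iteration counts as one oracle call. $\mathcal{O}(\cdot)$ hides constants depending only on $p,q$ and the subroutine. Restarted high-order AR method. Given $x_0$, $\nu_0\in\partial f(x_0)$, $L_{p+1}(g)$, $\sigma_q(f)$. For $k=1,2,\dots$: compute $(x_k,\nu_k)$ with $\nu_k\in\partial f(x_k)$ by running the high-order AR framework below on $f$ from $x_{k-1}$ for $m_k$ iterations, where $$m_k=\max\left\{\Big(\tfrac{qL_{p+1}(g)}{\sigma_q(f)}\Big)^{\frac{2}{3p+1}}\Big(\tfrac{q\|\nu_{k-1}\|}{2\sigma_q(f)}\Big)^{\frac{2(p-q+1)}{(3p+1)(q-1)}},\,1\right\};$$ if $\|\nu_k\|\le\varepsilon$, terminate with $\widehat{x}=x_k$. High-order AR framework (case $\nu=1$).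 From an initial point $y_0$ with strictly increasing $\{\sigma_s\}_{s=0}^S$, $\sigma_0=0$, for $s=1,\dots,S$ compute an approximate solution $y_s$ of $\min_x\{f_s(x):=f(x)+\sum_{i=1}^s\frac{\sigma_i-\sigma_{i-1}}{p+1}\|x-y_{i-1}\|^{p+1}\}$ by running a subroutine $\mathcal{A}_s$ from $y_{s-1}$ for $N_s$ iterations (for $2N_S$ iterations, with iterates $y_S^j$, in the last epoch). Write $y_s^*$ for the minimizer of $f_s$. The subroutine is assumed to satisfy, for a universal constant $c_{\mathcal{A}}$: $f_s(y_s)-f_s(y_s^* )\le c_{\mathcal{A}}L_{p+1}(g)\|y_s^*-y_{s-1}\|^{p+1}/N_s^{(3p+1)/2}$ for $1\le s\le S$ (in the last epoch also for $y_S^j$ with $j$ in place of $N_S$, $N_S\le j\le2N_S$), and there are $v_S^j\in\partial f_S(y_S^j)$ with $\min_{N_S<j\le2N_S}\|v_S^j\|\le c_{\mathcal{A}}L_{p+1}(g)\|y_S^*-y_{S-1}\|^p/N_S^{3p/2}$. Given a target accuracy $\delta$ and $D\ge\|y_0-x^*\|$, the parameters are, for a universal constant $C_{\mathcal{A}}$ depending only on $p$ and the subroutine, $S=\lceil\frac{2}{3p+1}\log_2\frac{C_{\mathcal{A}}D^pL_{p+1}(g)}{\delta}\rceil+1$, $\sigma_s=2^{(s-1)(3p+1)/2}\delta/(C_{\mathcal{A}}D^p)$, $N_s=\lceil4((p+1)c_{\mathcal{A}}L_{p+1}(g)/\sigma_s)^{2/(3p+1)}\rceil$; the output is a $y_S^j$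 ($N_S<j\le2N_S$) with smallest norm of the subgradient $v_S^j-\sum_{i=1}^S(\sigma_i-\sigma_{i-1})\|y_S^j-y_{i-1}\|^{p-1}(y_S^j-y_{i-1})\in\partial f(y_S^j)$, together with this subgradient. Running this framework "for $m$ iterations" from $y_0$ means running it with a total budget of $m$ iterations (up to universal constant factors and rounding), with $\delta$ chosen accordingly; its guarantee is that the output $(y,\mu)$, $\mu\in\partial f(y)$, satisfies $$\|\mu\|\le m^{-\frac{3p+1}{2}}L_{p+1}(g)\|y_0-x^*\|^p .$$
   Formalization: In (i) both factors, and in (ii) the power term, are replaced by at least 1; (ii) has σ_q/q in place of q/σ_q (kept only for σ_q≤q) plus a log log term in ‖ν_0‖ over log((q-1)/p); in (iii) log log is 0 where negative or undefined. *)

theory Defs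
  imports "HOL-Analysis.Analysis"
begin

definition proper_closed_convex :: "('a::real_normed_vector \<Rightarrow> ereal) \<Rightarrow> bool" where
  "proper_closed_convex f \<longleftrightarrow>
     (\<forall>x. f x \<noteq> -\<infinity>) \<and> (\<exists>x. f x \<noteq> \<infinity>) \<and>
     closed {(x, r::real). f x \<le> ereal r} \<and> convex {(x, r::real). f x \<le> ereal r}"

text \<open>Empty at points where \<open>f\<close> is not finite.\<close>

definition subdifferential :: "('a::real_inner \<Rightarrow> ereal) \<Rightarrow> 'a \<Rightarrow> 'a set" where
  "subdifferential f x = {v. \<bar>f x\<bar> \<noteq> \<infinity> \<and> (\<forall>y. f x + ereal (v \<bullet> (y - x)) \<le> f y)}"

definition uniformly_convex :: "real \<Rightarrow> real \<Rightarrow> ('a::real_inner \<Rightarrow> ereal) \<Rightarrow> bool" where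
  "uniformly_convex q \<sigma> f \<longleftrightarrow>
     (\<forall>x y. \<forall>v \<in> subdifferential f y.
        f y + ereal (v \<bullet> (x - y) + \<sigma> / q * norm (x - y) powr q) \<le> f x)"

text \<open>
  The \<open>k\<close>-linear form \<open>D\<^sup>k g(x)\<close> is the map sending a list \<open>vs\<close> of \<open>k\<close> directions to
  \<open>iterated_deriv g vs x\<close>. In finite dimension, Frechet differentiability (continuity) of
  a form-valued map is equivalent to that of each of its values on fixed directions.
\<close>

primrec iterated_deriv :: "('a::real_normed_vector \<Rightarrow> real) \<Rightarrow> 'a list \<Rightarrow> 'a \<Rightarrow> real" where
  "iterated_deriv g [] = g"
| "iterated_deriv g (v # vs) = (\<lambda>x. frechet_derivative (iterated_deriv g vs) (at x) v)"

definition times_cont_differentiable :: "nat \<Rightarrow> ('a::euclidean_space \<Rightarrow> real) \<Rightarrow> bool" where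
  "times_cont_differentiable p g \<longleftrightarrow>
     (\<forall>vs. length vs < p \<longrightarrow> (\<forall>x. iterated_deriv g vs differentiable (at x))) \<and>
     (\<forall>vs. length vs = p \<longrightarrow> continuous_on UNIV (iterated_deriv g vs))"

definition multilinear_norm :: "nat \<Rightarrow> ('a::real_normed_vector list \<Rightarrow> real) \<Rightarrow> real" where
  "multilinear_norm p M = (SUP vs \<in> {vs. length vs = p \<and> (\<forall>v \<in> set vs. norm v \<le> 1)}. \<bar>M vs\<bar>)"

definition ar_objective ::
    "nat \<Rightarrow> ('a::real_normed_vector \<Rightarrow> ereal) \<Rightarrow> (nat \<Rightarrow> real) \<Rightarrow> (nat \<Rightarrow> 'a) \<Rightarrow> nat \<Rightarrow> 'a \<Rightarrow> ereal"
  where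
  "ar_objective p f \<sigma> y s x =
     f x + ereal (\<Sum>i=1..s. (\<sigma> i - \<sigma> (i - 1)) / real (p + 1) * norm (x - y (i - 1)) ^ (p + 1))"

text \<open>
  The subgradient of \<open>f\<close> at \<open>z\<close> obtained from a subgradient \<open>v\<close> of the last regularized
  objective at \<open>z\<close> by subtracting the gradients of the \<open>S\<close> regularization terms.
\<close>

definition ar_subgradient ::
    "nat \<Rightarrow> (nat \<Rightarrow> real) \<Rightarrow> (nat \<Rightarrow> 'a::real_normed_vector) \<Rightarrow> nat \<Rightarrow> 'a \<Rightarrow> 'a \<Rightarrow> 'a" where
  "ar_subgradient p \<sigma> y S z v =
     v - (\<Sum>i=1..S. ((\<sigma> i - \<sigma> (i - 1)) * norm (z - y (i - 1)) ^ (p - 1)) *\<^sub>R (z - y (i - 1)))"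

text \<open>
  \<open>ar_framework p L cA CA f xstar D \<delta> y0 out \<mu> T\<close>: one execution of the framework on \<open>f\<close>,
  started at \<open>y0\<close> with target accuracy \<open>\<delta>\<close> and distance bound \<open>D\<close>, returns the point \<open>out\<close>
  with the subgradient \<open>\<mu>\<close> after \<open>T\<close> subroutine iterations, that is, \<open>T\<close> oracle calls.
  Here \<open>y s\<close> is the approximate and \<open>ys s\<close> the exact minimizer of the \<open>s\<close>-th regularized
  objective, and \<open>z j\<close> (with subgradient \<open>v j\<close>) is the \<open>j\<close>-th iterate of the last epoch.
  The subroutine enters only through the accuracy it is assumed to deliver.
\<close>

definition ar_framework ::
    "nat \<Rightarrow> real \<Rightarrow> real \<Rightarrow> real \<Rightarrow> ('a::euclidean_space \<Rightarrow> ereal) \<Rightarrow> 'a \<Rightarrow> real \<Rightarrow> real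
       \<Rightarrow> 'a \<Rightarrow> 'a \<Rightarrow> 'a \<Rightarrow> nat \<Rightarrow> bool" where
  "ar_framework p L cA CA f xstar D \<delta> y0 out \<mu> T \<longleftrightarrow>
     0 < D \<and> norm (y0 - xstar) \<le> D \<and> 0 < \<delta> \<and>
     (\<exists>(S::nat) (\<sigma>::nat \<Rightarrow> real) (N::nat \<Rightarrow> nat) y ys z v.
        1 \<le> S \<and> int S = \<lceil>2 / (3 * real p + 1) * log 2 (CA * D ^ p * L / \<delta>)\<rceil> + 1 \<and>
        \<sigma> 0 = 0 \<and>
        (\<forall>s\<in>{1..S}. \<sigma> s = 2 powr ((real s - 1) * (3 * real p + 1) / 2) * \<delta> / (CA * D ^ p)) \<and>
        (\<forall>s\<in>{1..S}.
           N s = nat \<lceil>4 * (real (p + 1) * cA * L / \<sigma> s) powr (2 / (3 * real p + 1))\<rceil>) \<and>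
        y 0 = y0 \<and> y S = z (2 * N S) \<and>
        (\<forall>s\<in>{1..S}. \<forall>x. ar_objective p f \<sigma> y s (ys s) \<le> ar_objective p f \<sigma> y s x) \<and>
        (\<forall>s\<in>{1..S}. ar_objective p f \<sigma> y s (y s) \<le> ar_objective p f \<sigma> y s (ys s) +
           ereal (cA * L * norm (ys s - y (s - 1)) ^ (p + 1)
                  / real (N s) powr ((3 * real p + 1) / 2))) \<and>
        (\<forall>j\<in>{N S..2 * N S}. ar_objective p f \<sigma> y S (z j) \<le> ar_objective p f \<sigma> y S (ys S) +
           ereal (cA * L * norm (ys S - y (S - 1)) ^ (p + 1)
                  / real j powr ((3 * real p + 1) / 2))) \<and>
        (\<forall>j\<in>{N S<..2 * N S}. v j \<in> subdifferential (ar_objective p f \<sigma> y S) (z j)) \<and>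
        (MIN j\<in>{N S<..2 * N S}. norm (v j))
           \<le> cA * L * norm (ys S - y (S - 1)) ^ p / real (N S) powr (3 * real p / 2) \<and>
        (\<exists>j\<in>{N S<..2 * N S}.
           out = z j \<and> \<mu> = ar_subgradient p \<sigma> y S (z j) (v j) \<and>
           (\<forall>i\<in>{N S<..2 * N S}. norm \<mu> \<le> norm (ar_subgradient p \<sigma> y S (z i) (v i)))) \<and>
        T = (\<Sum>s=1..<S. N s) + 2 * N S)"

text \<open>
  Running the framework for \<open>m\<close> iterations: the accuracy \<open>\<delta>\<close> is chosen such that the total
  number of iterations is within the budget, \<open>T \<le> cb * m\<close> for a universal factor \<open>cb\<close> that
  also covers rounding (budgets satisfy \<open>m \<ge> 1\<close>), and such that the output meets the
  convergence guarantee of the framework for that budget.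
\<close>

definition ar_run ::
    "nat \<Rightarrow> real \<Rightarrow> real \<Rightarrow> real \<Rightarrow> real \<Rightarrow> ('a::euclidean_space \<Rightarrow> ereal) \<Rightarrow> 'a
       \<Rightarrow> real \<Rightarrow> 'a \<Rightarrow> 'a \<Rightarrow> 'a \<Rightarrow> nat \<Rightarrow> bool" where
  "ar_run p L cA CA cb f xstar m y0 out \<mu> T \<longleftrightarrow>
     (\<exists>D \<delta>. ar_framework p L cA CA f xstar D \<delta> y0 out \<mu> T) \<and>
     real T \<le> cb * m \<and>
     \<mu> \<in> subdifferential f out \<and>
     norm \<mu> \<le> m powr (- (3 * real p + 1) / 2) * L * norm (y0 - xstar) ^ p"

definition restart_length :: "nat \<Rightarrow> real \<Rightarrow> real \<Rightarrow> real \<Rightarrow> real \<Rightarrow> real" where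
  "restart_length p q L \<sigma> r =
     max ((q * L / \<sigma>) powr (2 / (3 * real p + 1)) *
          (q * r / (2 * \<sigma>)) powr (2 * (real p - q + 1) / ((3 * real p + 1) * (q - 1)))) 1"

text \<open>
  \<open>x\<close>, \<open>\<nu>\<close> are the iterates of the method with their subgradients (the input being \<open>x 0\<close>, \<open>\<nu> 0\<close>),
  \<open>T k\<close> the number of oracle calls of the \<open>k\<close>-th restart. The \<open>k\<close>-th restart takes place
  unless the method has terminated before; later entries of the sequences are irrelevant.
\<close>

definition restarted_ar ::
    "nat \<Rightarrow> real \<Rightarrow> real \<Rightarrow> real \<Rightarrow> real \<Rightarrow> real \<Rightarrow> real \<Rightarrow> ('a::euclidean_space \<Rightarrow> ereal) \<Rightarrow> 'a
       \<Rightarrow> real \<Rightarrow> (nat \<Rightarrow> 'a) \<Rightarrow> (nat \<Rightarrow> 'a) \<Rightarrow> (nat \<Rightarrow> nat) \<Rightarrow> bool" where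
  "restarted_ar p q L \<sigma> cA CA cb f xstar \<epsilon> x \<nu> T \<longleftrightarrow>
     (\<forall>k\<ge>1. (\<forall>j\<in>{1..<k}. \<epsilon> < norm (\<nu> j)) \<longrightarrow>
        ar_run p L cA CA cb f xstar (restart_length p q L \<sigma> (norm (\<nu> (k - 1))))
          (x (k - 1)) (x k) (\<nu> k) (T k))"

text \<open>
  The constant hidden by the O-notation is exhibited, up to the budget factor \<open>cb\<close>: it depends
  on \<open>p\<close> and \<open>q\<close> only. An existential constant inside a theorem about a fixed space type would
  be allowed to depend on the dimension.
\<close>

definition restart_const :: "nat \<Rightarrow> real \<Rightarrow> real" where
  "restart_const p q =
     (if q = real p + 1 then 3
      else let \<eta> = 2 * \<bar>real p - q + 1\<bar> / ((3 * real p + 1) * (q - 1));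
               \<rho> = \<bar>ln (real p / (q - 1))\<bar>
           in 3 + 2 powr \<eta> / (1 - 2 powr (- \<eta>)) + 2 * \<rho> + (2 + 1 / \<rho>) * exp (3 * \<eta>))"

text \<open>
  In the bounds, a factor whose printed value may drop below the cost of a single oracle call
  (each restart costs at least one) is read as \<open>max 1\<close> of it.  If \<open>q > p + 1\<close>, the restarts of
  length 1 that precede the growth of the restart lengths contribute the additional iterated
  logarithm; it vanishes if the first restart length exceeds 1.  The factor \<open>\<sigma> / q\<close> in that case
  is the one produced by summing the restart lengths; it is at most \<open>q / \<sigma>\<close> iff \<open>\<sigma> \<le> q\<close>.
  With \<open>q / \<sigma>\<close> and no restriction on \<open>\<sigma>\<close> the bound would fail: unlike the number of calls, it
  is not invariant under scaling of \<open>f\<close>.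

  The iterated logarithm is continued by \<open>0\<close> below \<open>exp 1\<close>, where \<open>ln (ln t)\<close> is negative or undefined.
\<close>

definition lnln :: "real \<Rightarrow> real" where
  "lnln t = ln (max 1 (ln t))"

end

theory Submission
  imports Defs
begin

text \<open>
  Uniform convexity bounds the distance \<open>d\<close> of a point to the minimizer by the norm \<open>r\<close> of a
  subgradient there: \<open>2 \<sigma> / q * d\<^sup>q\<^sup>-\<^sup>1 \<le> r\<close>. Substituted into the guarantee of a single run, this
  gives the next subgradient norm \<open>r'\<close> in terms of \<open>r\<close>. If \<open>q \<noteq> p + 1\<close>, then after rescaling to
  \<open>w = \<kappa> r\<close> the restart length is \<open>max 1 (w\<^sup>e)\<close>, with \<open>e\<close> of the sign of \<open>p + 1 - q\<close>, and
  \<open>w' \<le> w / 2\<close>, \<open>w' \<le> w\<^sup>\<tau> / 2\<close> for \<open>\<tau> = p / (q - 1)\<close>. The restart lengths exceeding 1 form a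
  geometric sum by the first inequality. The number of restarts of length 1 is doubly logarithmic
  by the second one, since \<open>ln w\<close> is multiplied by about \<open>\<tau>\<close> in each of them.
\<close>

section \<open>Uniform convexity and the contraction achieved by one restart\<close>

text \<open>Uniform convexity enters twice: at \<open>xstar\<close> with the subgradient 0, and at
  \<open>y\<close> with \<open>v\<close>. Adding the two inequalities produces the factor 2;
  Cauchy-Schwarz and division by the distance finish.\<close>

lemma uniformly_convex_subgradient_growth:
  fixes f :: "'a::real_inner \<Rightarrow> ereal"
  assumes "uniformly_convex q \<sigma> f" and min: "\<And>y. f xstar \<le> f y" and "f xstar \<noteq> -\<infinity>"
    and v: "v \<in> subdifferential f y"
  shows "2 * \<sigma> / q * norm (y - xstar) powr (q - 1) \<le> norm v"
proof (cases "y = xstar")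
  case False
  define d where "d = norm (y - xstar)"
  have d: "0 < d" using False by (simp add: d_def)
  have "\<bar>f y\<bar> \<noteq> \<infinity>" using v by (simp add: subdifferential_def)
  then obtain a where a: "f y = ereal a" by auto
  obtain b where b: "f xstar = ereal b"
    using min[of y] a assms(3) by (cases "f xstar") auto
  have "0 \<in> subdifferential f xstar"
    using min b by (simp add: subdifferential_def)
  then have "f xstar + ereal (0 \<bullet> (y - xstar) + \<sigma> / q * norm (y - xstar) powr q) \<le> f y"
    using assms(1) unfolding uniformly_convex_def by blast
  then have 1: "b + \<sigma> / q * d powr q \<le> a" by (simp add: a b d_def)
  have "f y + ereal (v \<bullet> (xstar - y) + \<sigma> / q * norm (xstar - y) powr q) \<le> f xstar"
    using assms(1) v unfolding uniformly_convex_def by blast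
  then have 2: "a + (v \<bullet> (xstar - y) + \<sigma> / q * d powr q) \<le> b"
    by (simp add: a b d_def norm_minus_commute)
  have "- (v \<bullet> (xstar - y)) \<le> norm v * d"
    using Cauchy_Schwarz_ineq2[of v "xstar - y"] by (simp add: d_def norm_minus_commute)
  then have "2 * \<sigma> / q * d powr q \<le> norm v * d" using 1 2 by simp
  moreover have "d powr q = d powr (q - 1) * d"
    using powr_add[of d "q - 1" 1] d by simp
  ultimately have "(2 * \<sigma> / q * d powr (q - 1)) * d \<le> norm v * d" by (simp add: mult.assoc)
  then have "2 * \<sigma> / q * d powr (q - 1) \<le> norm v"
    using d mult_le_cancel_right_pos by blast
  then show ?thesis by (simp add: d_def)
qed simp

lemma minimizer_distance_bound:
  fixes d r q \<sigma> :: real and p :: nat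
  assumes "0 \<le> d" "1 < q" "0 < \<sigma>" "0 < r" "1 \<le> p" and "2 * \<sigma> / q * d powr (q - 1) \<le> r"
  shows "d ^ p \<le> (q * r / (2 * \<sigma>)) powr (real p / (q - 1))"
proof (cases "d = 0")
  case False
  then have d: "0 < d" using assms(1) by simp
  have "d powr (q - 1) \<le> q * r / (2 * \<sigma>)" using assms by (simp add: field_simps)
  then have "(d powr (q - 1)) powr (real p / (q - 1)) \<le> (q * r / (2 * \<sigma>)) powr (real p / (q - 1))"
    using assms by (intro powr_mono2) auto
  then show ?thesis using d assms(2) by (simp add: powr_powr powr_realpow)
qed (use assms in \<open>simp add: power_0_left\<close>)

text \<open>\<open>m\<close> is a maximum, and each of its two arguments yields one conclusion:
  \<open>1 \<le> m\<close> gives the power bound, the other argument gives the halving.\<close>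

lemma restart_contraction:
  fixes d r r' q \<sigma> L :: real and p :: nat
  defines "m \<equiv> restart_length p q L \<sigma> r"
  assumes "0 \<le> d" "1 < q" "0 < \<sigma>" "0 < L" "0 < r" "1 \<le> p" and "2 * \<sigma> / q * d powr (q - 1) \<le> r"
    and r': "r' \<le> m powr (- (3 * real p + 1) / 2) * L * d ^ p"
  shows "r' \<le> L * (q * r / (2 * \<sigma>)) powr (real p / (q - 1))" and "r' \<le> r / 2"
proof -
  define u where "u = q * r / (2 * \<sigma>)"
  define t where "t = (3 * real p + 1) / 2"
  have u: "0 < u" using assms by (simp add: u_def)
  have t: "0 < t" by (simp add: t_def)
  have d: "d ^ p \<le> u powr (real p / (q - 1))"
    unfolding u_def by (rule minimizer_distance_bound) (use assms in auto)
  have r'': "r' \<le> m powr (- t) * L * u powr (real p / (q - 1))"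
  proof (rule order_trans)
    have "- (3 * real p + 1) / 2 = - t" by (simp add: t_def field_simps)
    with r' show "r' \<le> m powr (- t) * L * d ^ p" by simp
  qed (intro mult_left_mono d, use assms in simp)
  have m1: "1 \<le> m" by (simp add: m_def restart_length_def)
  have "m powr (- t) \<le> 1 powr (- t)" using m1 t by (intro powr_mono2') auto
  then have "m powr (- t) * (L * u powr (real p / (q - 1))) \<le> 1 * (L * u powr (real p / (q - 1)))"
    using assms by (intro mult_right_mono) auto
  with r'' show "r' \<le> L * (q * r / (2 * \<sigma>)) powr (real p / (q - 1))"
    unfolding u_def[symmetric] by (simp add: mult.assoc)
  \<comment> \<open>\<open>a\<close> is the first argument of the maximum, with its exponents
    written in terms of \<open>t\<close>. The factor \<open>a powr (- t)\<close> turns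
    \<open>L\<close> into \<open>\<sigma> / q\<close> and lowers the exponent of \<open>u\<close>
    from \<open>p / (q - 1)\<close> to 1, which leaves
    \<open>\<sigma> / q * u = r / 2\<close>.\<close>
  define a where "a = (q * L / \<sigma>) powr (1 / t) * u powr ((real p - q + 1) / (q - 1) / t)"
  have Q: "0 < q * L / \<sigma>" using assms by simp
  have a: "0 < a" unfolding a_def by (intro mult_pos_pos iffD2[OF powr_gt_zero] less_imp_neq[symmetric] Q u)
  have "a \<le> m"
    unfolding m_def restart_length_def a_def u_def t_def by (simp add: mult_ac)
  then have "m powr (- t) \<le> a powr (- t)" using a t by (intro powr_mono2') auto
  also have "a powr (- t) = (q * L / \<sigma>) powr (- 1) * u powr (- ((real p - q + 1) / (q - 1)))"
    unfolding a_def using Q u t by (simp add: powr_mult powr_powr)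
  finally have "m powr (- t) * (L * u powr (real p / (q - 1))) \<le>
      ((q * L / \<sigma>) powr (- 1) * u powr (- ((real p - q + 1) / (q - 1)))) * (L * u powr (real p / (q - 1)))"
    using assms by (intro mult_right_mono) auto
  also have "\<dots> = (q * L / \<sigma>) powr (- 1) * L * u powr (- ((real p - q + 1) / (q - 1)) + real p / (q - 1))"
    by (simp only: powr_add mult_ac)
  also have "- ((real p - q + 1) / (q - 1)) + real p / (q - 1) = 1"
    using assms(3) by (simp add: divide_simps)
  also have "(q * L / \<sigma>) powr (- 1) * L * u powr 1 = r / 2"
    using assms Q u by (simp add: powr_minus u_def field_simps)
  finally show "r' \<le> r / 2" using r'' by (simp add: mult.assoc)
qed

section \<open>Rescaled subgradient norms\<close>

text \<open>The power of \<open>q * L / \<sigma>\<close> inside \<kappa> is the one whose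
  \<open>e\<close>-th power is the prefactor of the restart length, so that the length depends on
  \<open>\<kappa> * r\<close> alone.\<close>

lemma rescaled_powr:
  fixes q L \<sigma> r :: real and p :: nat
  defines "\<kappa> \<equiv> q / (2 * \<sigma>) * (q * L / \<sigma>) powr ((q - 1) / (real p - q + 1))"
    and "e \<equiv> 2 * (real p - q + 1) / ((3 * real p + 1) * (q - 1))"
  assumes "1 < q" "q \<noteq> real p + 1"
  shows "(\<kappa> * r) powr e = (q * L / \<sigma>) powr (2 / (3 * real p + 1)) * (q * r / (2 * \<sigma>)) powr e"
proof -
  define P where "P = (q * L / \<sigma>) powr ((q - 1) / (real p - q + 1))"
  have "real p - q + 1 \<noteq> 0" using assms by simp
  then have "(q - 1) / (real p - q + 1) * e = 2 / (3 * real p + 1)"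
    using assms(3) unfolding e_def by (simp add: divide_simps)
  then have "P powr e = (q * L / \<sigma>) powr (2 / (3 * real p + 1))"
    by (simp only: P_def powr_powr)
  moreover have "\<kappa> * r = P * (q * r / (2 * \<sigma>))" by (simp add: \<kappa>_def P_def)
  moreover have "(P * (q * r / (2 * \<sigma>))) powr e = P powr e * (q * r / (2 * \<sigma>)) powr e"
    by (rule powr_mult)
  ultimately show ?thesis by simp
qed

lemma restart_length_rescaled:
  fixes q L \<sigma> r :: real and p :: nat
  defines "\<kappa> \<equiv> q / (2 * \<sigma>) * (q * L / \<sigma>) powr ((q - 1) / (real p - q + 1))"
  assumes "1 < q" "q \<noteq> real p + 1"
  shows "restart_length p q L \<sigma> r =
    max 1 ((\<kappa> * r) powr (2 * (real p - q + 1) / ((3 * real p + 1) * (q - 1))))"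
  by (simp only: \<kappa>_def restart_length_def rescaled_powr[OF assms(2-)] max.commute)

text \<open>The same \<kappa> also absorbs \<open>L\<close> in the power bound:
  \<open>\<kappa> * L = Q powr (\<alpha> + 1) / 2\<close>, and
  \<open>\<alpha> + 1 = \<alpha> * \<tau>\<close> makes this
  \<open>(Q powr \<alpha>) powr \<tau> / 2\<close>.\<close>

lemma rescaled_step:
  fixes q L \<sigma> r r' :: real and p :: nat
  defines "\<kappa> \<equiv> q / (2 * \<sigma>) * (q * L / \<sigma>) powr ((q - 1) / (real p - q + 1))"
  assumes "1 < q" "0 < \<sigma>" "0 < L" "0 < r" "q \<noteq> real p + 1"
    and "r' \<le> L * (q * r / (2 * \<sigma>)) powr (real p / (q - 1))"
  shows "\<kappa> * r' \<le> (\<kappa> * r) powr (real p / (q - 1)) / 2"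
proof -
  define Q \<alpha> \<tau> where "Q = q * L / \<sigma>" and "\<alpha> = (q - 1) / (real p - q + 1)" and "\<tau> = real p / (q - 1)"
  have Q: "0 < Q" using assms by (simp add: Q_def)
  have \<kappa>: "\<kappa> = q / (2 * \<sigma>) * Q powr \<alpha>" by (simp add: \<kappa>_def Q_def \<alpha>_def)
  have ne: "real p - q + 1 \<noteq> 0" using assms by simp
  have \<alpha>: "\<alpha> + 1 = \<alpha> * \<tau>"
    using assms(2) ne by (simp add: \<alpha>_def \<tau>_def divide_simps)
  have "\<kappa> * r' \<le> \<kappa> * (L * (q * r / (2 * \<sigma>)) powr \<tau>)"
    using assms by (intro mult_left_mono) (auto simp: \<tau>_def)
  also have "\<dots> = Q powr (\<alpha> + 1) * (q * r / (2 * \<sigma>)) powr \<tau> / 2"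
    unfolding \<kappa> powr_add using Q assms(3) by (simp add: abs_of_pos) (simp add: Q_def field_simps)
  also have "Q powr (\<alpha> + 1) = (Q powr \<alpha>) powr \<tau>" unfolding \<alpha> by (simp add: powr_powr)
  also have "(Q powr \<alpha>) powr \<tau> * (q * r / (2 * \<sigma>)) powr \<tau> = (\<kappa> * r) powr \<tau>"
    unfolding \<kappa> using assms by (subst powr_mult[symmetric]) (auto simp: mult_ac)
  finally show ?thesis by (simp add: \<tau>_def)
qed

section \<open>Geometric and iterated-logarithm estimates\<close>

lemma geometric_sum_le:
  fixes b :: real
  assumes "0 \<le> b" "b < 1"
  shows "(\<Sum>k<n. b ^ k) \<le> 1 / (1 - b)"
  using assms by (simp add: sum_gp_strict divide_right_mono)

lemma geometric_decay:
  fixes w :: "nat \<Rightarrow> real"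
  assumes "\<And>k. Suc k < K \<Longrightarrow> w (Suc k) \<le> w k / 2" and "i \<le> j" "j < K"
  shows "w j \<le> w i / 2 ^ (j - i)"
  using assms(2,3)
proof (induction j rule: dec_induct)
  case (step j)
  have "w (Suc j) \<le> w j / 2" using assms(1) step by simp
  then show ?case using step by (simp add: Suc_diff_le)
qed simp

lemma lnln_nonneg: "0 \<le> lnln t"
  by (simp add: lnln_def)

text \<open>This converts a logarithm that grows like \<open>a ^ n\<close> into a bound on
  \<open>n\<close>, the number of restarts of length 1. The summand 1 pays for replacing
  \<open>ln 2\<close> by the smaller \<open>exp (- 1)\<close>.\<close>

lemma exponent_le_lnln:
  fixes a t :: real
  assumes "0 < a" "a ^ n * ln 2 \<le> ln t"
  shows "real n * ln a \<le> 1 + lnln t"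
proof -
  have e: "exp (- 1) \<le> ln (2 :: real)"
  proof -
    have "exp (- 1 :: real) = 1 / exp 1" by (simp add: exp_minus inverse_eq_divide)
    also have "\<dots> \<le> 1 / 2"
      using exp_ge_add_one_self[of "1::real"] by (intro divide_left_mono) auto
    also have "\<dots> \<le> ln 2" using ln2_ge_two_thirds by simp
    finally show ?thesis .
  qed
  have "a ^ n * exp (- 1) \<le> a ^ n * ln 2" using e assms by (intro mult_left_mono) auto
  also have "\<dots> \<le> max 1 (ln t)" using assms by simp
  finally have "ln (a ^ n * exp (- 1)) \<le> ln (max 1 (ln t))" using assms by (subst ln_le_cancel_iff) auto
  then show ?thesis using assms by (simp add: ln_mult ln_realpow lnln_def)
qed

text \<open>Restarts cut off to length 1 are merely counted; the uncut lengths remain for a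
  geometric sum.\<close>

lemma sum_max_one_le:
  fixes a :: "nat \<Rightarrow> real"
  assumes "\<And>k. k < K \<Longrightarrow> 0 \<le> a k"
  shows "(\<Sum>k<K. max 1 (a k)) \<le> (\<Sum>k<K. a k) + real (card {k. k < K \<and> a k \<le> 1})"
proof -
  have "(\<Sum>k<K. max 1 (a k)) \<le> (\<Sum>k<K. a k + (if a k \<le> 1 then 1 else 0))"
    using assms by (intro sum_mono) auto
  also have "\<dots> = (\<Sum>k<K. a k) + real (card {k. k < K \<and> a k \<le> 1})"
    by (simp add: sum.distrib sum.If_cases lessThan_def Int_def)
  finally show ?thesis .
qed

section \<open>Sums of restart lengths\<close>

text \<open>This serves \<open>q > p + 1\<close>, where the uncut lengths grow as \<open>w\<close>
  decays. The geometric sum therefore runs backwards from the last restart, where \<open>w\<close>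
  is still at least \<omega>. Restarts of length 1 have \<open>1 \<le> w k\<close>, and iterating
  the power inequality bounds their index.\<close>

lemma sum_restart_lengths_sublinear:
  fixes w :: "nat \<Rightarrow> real"
  assumes \<tau>: "0 < \<tau>" "\<tau> < 1" and \<eta>: "0 < \<eta>" and \<omega>: "0 < \<omega>" "\<And>k. k < K \<Longrightarrow> \<omega> \<le> w k"
    and half: "\<And>k. Suc k < K \<Longrightarrow> w (Suc k) \<le> w k / 2"
    and pow: "\<And>k. Suc k < K \<Longrightarrow> w (Suc k) \<le> w k powr \<tau> / 2"
  shows "(\<Sum>k<K. max 1 (w k powr (- \<eta>))) \<le>
    \<omega> powr (- \<eta>) / (1 - 2 powr (- \<eta>)) + 1 + (1 + lnln (2 * w 0)) / ln (1 / \<tau>)"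
proof -
  define b where "b = (2::real) powr (- \<eta>)"
  have b: "0 < b" "b < 1" using \<eta> by (auto simp: b_def powr_less_one)
  have wpos: "0 < w k" if "k < K" for k using \<omega>(2)[OF that] \<omega>(1) by simp
  have "(\<Sum>k<K. w k powr (- \<eta>)) \<le> (\<Sum>k<K. \<omega> powr (- \<eta>) * b ^ (K - Suc k))"
  proof (rule sum_mono)
    fix k assume "k \<in> {..<K}"
    then have k: "k < K" by simp
    have "\<omega> \<le> w k / 2 ^ (K - 1 - k)"
      using \<omega>(2)[of "K - 1"] geometric_decay[of K w k "K - 1"] half k by force
    then have "\<omega> * 2 ^ (K - 1 - k) \<le> w k" by (simp add: field_simps)
    then have "w k powr (- \<eta>) \<le> (\<omega> * 2 ^ (K - 1 - k)) powr (- \<eta>)"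
      using \<omega>(1) \<eta> by (intro powr_mono2') auto
    also have "\<dots> = \<omega> powr (- \<eta>) * b ^ (K - Suc k)"
      using \<omega>(1) by (simp add: powr_mult b_def powr_powr powr_realpow[symmetric] mult.commute)
    finally show "w k powr (- \<eta>) \<le> \<omega> powr (- \<eta>) * b ^ (K - Suc k)" .
  qed
  also have "\<dots> = \<omega> powr (- \<eta>) * (\<Sum>k<K. b ^ k)"
    by (simp add: sum_distrib_left[symmetric] sum.nat_diff_reindex)
  also have "\<dots> \<le> \<omega> powr (- \<eta>) * (1 / (1 - b))"
    using b by (intro mult_left_mono geometric_sum_le) auto
  finally have geo: "(\<Sum>k<K. w k powr (- \<eta>)) \<le> \<omega> powr (- \<eta>) / (1 - b)" by simp

  define B where "B = (1 + lnln (2 * w 0)) / ln (1 / \<tau>)"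
  have \<rho>: "0 < ln (1 / \<tau>)" using \<tau> by simp
  have B: "0 \<le> B" using \<rho> lnln_nonneg[of "2 * w 0"] by (simp add: B_def)
  have iter: "w k \<le> w 0 powr (\<tau> ^ k)" if "k < K" for k
    using that
  proof (induction k)
    case 0 then show ?case using wpos[of 0] by simp
  next
    case (Suc k)
    have "w (Suc k) \<le> w k powr \<tau> / 2" using pow Suc by simp
    also have "\<dots> \<le> w k powr \<tau>" by simp
    also have "\<dots> \<le> (w 0 powr (\<tau> ^ k)) powr \<tau>"
      using Suc wpos[of k] \<tau> by (intro powr_mono2) auto
    finally show ?case by (simp add: powr_powr mult.commute)
  qed
  have small: "real k \<le> B" if k: "k < K" "w k powr (- \<eta>) \<le> 1" for k
  proof (cases k)
    case (Suc j)
    have "1 \<le> w k"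
    proof (rule ccontr)
      assume "\<not> 1 \<le> w k"
      then have "1 < w k powr (- \<eta>)"
        using powr_less_mono2_neg[of "- \<eta>" "w k" 1] wpos[OF k(1)] \<eta> by simp
      with k(2) show False by simp
    qed
    have w0: "0 < w 0" using wpos[of 0] k by simp
    \<comment> \<open>The factor 1/2 of \<open>pow\<close> is dropped in \<open>iter\<close> but
      kept in the step from \<open>j\<close> to \<open>k\<close>. It yields the lower bound 2 for
      \<open>w 0 powr (\<tau> ^ k)\<close>; the lower bound 1 would not restrict
      \<open>k\<close>.\<close>
    have "w j powr \<tau> \<le> (w 0 powr (\<tau> ^ j)) powr \<tau>"
      using iter[of j] wpos[of j] k Suc \<tau> by (intro powr_mono2) auto
    then have "2 \<le> w 0 powr (\<tau> ^ k)"
      using pow[of j] \<open>1 \<le> w k\<close> k Suc by (simp add: powr_powr mult.commute)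
    then have "ln 2 \<le> ln (w 0 powr (\<tau> ^ k))" using w0 by (subst ln_le_cancel_iff) auto
    then have "ln 2 \<le> \<tau> ^ k * ln (w 0)" using w0 by (simp add: ln_powr)
    then have "(1 / \<tau>) ^ k * ln 2 \<le> ln (w 0)" using \<tau> by (simp add: power_one_over field_simps)
    also have "\<dots> \<le> ln (2 * w 0)" using w0 by simp
    finally have "real k * ln (1 / \<tau>) \<le> 1 + lnln (2 * w 0)"
      using \<tau> by (intro exponent_le_lnln) auto
    then show ?thesis using \<rho> by (simp add: B_def pos_le_divide_eq)
  qed (use B in simp)
  \<comment> \<open>Index 0 is among the counted ones, hence \<open>1 + B\<close> and not
    \<open>B\<close>.\<close>
  have "{k. k < K \<and> w k powr (- \<eta>) \<le> 1} \<subseteq> {..nat \<lfloor>B\<rfloor>}"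
    using small by (auto simp: le_nat_floor)
  then have "card {k. k < K \<and> w k powr (- \<eta>) \<le> 1} \<le> card {..nat \<lfloor>B\<rfloor>}" by (intro card_mono) auto
  then have "real (card {k. k < K \<and> w k powr (- \<eta>) \<le> 1}) \<le> 1 + real (nat \<lfloor>B\<rfloor>)" by simp
  also have "\<dots> \<le> 1 + B" using B by simp
  finally show ?thesis
    using geo sum_max_one_le[of K "\<lambda>k. w k powr (- \<eta>)"] unfolding b_def B_def by simp
qed

text \<open>This is the mirror image for \<open>q < p + 1\<close>. The uncut lengths shrink, so the
  geometric sum starts at \<open>w 0\<close>. Restarts of length 1 now have
  \<open>w k \<le> 1\<close>, where the power inequality forces doubly exponential decay until
  \<omega> is reached.\<close>

lemma sum_restart_lengths_superlinear:
  fixes w :: "nat \<Rightarrow> real"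
  assumes \<tau>: "1 < \<tau>" and \<eta>: "0 < \<eta>" and \<omega>: "0 < \<omega>" "\<And>k. k < K \<Longrightarrow> \<omega> \<le> w k"
    and half: "\<And>k. Suc k < K \<Longrightarrow> w (Suc k) \<le> w k / 2"
    and pow: "\<And>k. Suc k < K \<Longrightarrow> w (Suc k) \<le> w k powr \<tau> / 2"
  shows "(\<Sum>k<K. max 1 (w k powr \<eta>)) \<le>
    w 0 powr \<eta> / (1 - 2 powr (- \<eta>)) + 2 + (1 + lnln (1 / (2 * \<omega>))) / ln \<tau>"
proof -
  define b where "b = (2::real) powr (- \<eta>)"
  have b: "0 < b" "b < 1" using \<eta> by (auto simp: b_def powr_less_one)
  have wpos: "0 < w k" if "k < K" for k using \<omega>(2)[OF that] \<omega>(1) by simp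
  have "(\<Sum>k<K. w k powr \<eta>) \<le> (\<Sum>k<K. w 0 powr \<eta> * b ^ k)"
  proof (rule sum_mono)
    fix k assume "k \<in> {..<K}"
    then have k: "k < K" by simp
    then have w0: "0 < w 0" using wpos[of 0] by simp
    have "w k powr \<eta> \<le> (w 0 / 2 ^ k) powr \<eta>"
      using geometric_decay[of K w 0 k] half k wpos[OF k] \<eta> by (intro powr_mono2) auto
    also have "\<dots> = w 0 powr \<eta> * b ^ k"
    proof -
      have "w 0 / 2 ^ k = w 0 * 2 powr (- real k)" by (simp add: powr_minus powr_realpow field_simps)
      moreover have "b ^ k = (2 powr (- real k)) powr \<eta>"
        by (simp add: b_def powr_powr powr_realpow[symmetric] mult.commute)
      ultimately show ?thesis using w0 by (simp add: powr_mult)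
    qed
    finally show "w k powr \<eta> \<le> w 0 powr \<eta> * b ^ k" .
  qed
  also have "\<dots> = w 0 powr \<eta> * (\<Sum>k<K. b ^ k)" by (simp add: sum_distrib_left)
  also have "\<dots> \<le> w 0 powr \<eta> * (1 / (1 - b))"
    using b by (intro mult_left_mono geometric_sum_le) auto
  finally have geo: "(\<Sum>k<K. w k powr \<eta>) \<le> w 0 powr \<eta> / (1 - b)" by simp

  define Z where "Z = 1 / (2 * \<omega>)"
  define B where "B = (1 + lnln Z) / ln \<tau>"
  define A where "A = {k. k < K \<and> w k powr \<eta> \<le> 1}"
  have \<rho>: "0 < ln \<tau>" using \<tau> by simp
  have B: "0 \<le> B" using \<rho> lnln_nonneg[of Z] by (simp add: B_def)
  have card: "real (card A) \<le> 2 + B"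
  proof (cases "A = {}")
    case False
    define a where "a = Min A"
    have "finite A" by (simp add: A_def)
    then have "a \<in> A" and min: "\<And>k. k \<in> A \<Longrightarrow> a \<le> k" using False by (auto simp: a_def)
    then have a: "a < K" "w a powr \<eta> \<le> 1" by (auto simp: A_def)
    have wa: "w a \<le> 1"
    proof (rule ccontr)
      assume "\<not> w a \<le> 1"
      then have "1 powr \<eta> < w a powr \<eta>" using \<eta> by (intro powr_less_mono2) auto
      with a(2) show False by simp
    qed
    \<comment> \<open>The induction starts one index after \<open>a\<close>: the halving first turns
      \<open>w a \<le> 1\<close> into a bound 1/2, a base below 1 on which the powers act.\<close>
    have iter: "w (Suc (a + j)) \<le> 2 powr (- (\<tau> ^ j))" if "Suc (a + j) < K" for j
      using that
    proof (induction j)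
      case 0
      have "w (Suc a) \<le> w a / 2" using half 0 by simp
      then show ?case using wa by (simp add: powr_minus)
    next
      case (Suc j)
      have "w (Suc (a + Suc j)) \<le> w (Suc (a + j)) powr \<tau> / 2" using pow Suc by simp
      also have "\<dots> \<le> w (Suc (a + j)) powr \<tau>" by simp
      also have "\<dots> \<le> (2 powr (- (\<tau> ^ j))) powr \<tau>"
        using Suc wpos[of "Suc (a + j)"] \<tau> by (intro powr_mono2) auto
      finally show ?case by (simp add: powr_powr mult.commute)
    qed
    have bound: "real (K - a) \<le> 2 + B"
    proof (cases "K - a \<le> 2")
      case False
      \<comment> \<open>The logarithm controls \<open>Suc j\<close>, and
        \<open>K - a = Suc j + 2\<close> explains the 2 in the bound. The last step before index
        \<open>K - 1\<close> keeps its factor 1/2, which becomes the 2 in \<open>Z\<close>.\<close>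
      define j where "j = K - a - 3"
      have K: "K = Suc (Suc (Suc (a + j)))" using False by (simp add: j_def)
      have "\<omega> \<le> w (Suc (Suc (a + j)))" using \<omega>(2) K by simp
      also have "\<dots> \<le> w (Suc (a + j)) powr \<tau> / 2" using pow K by simp
      also have "\<dots> \<le> (2 powr (- (\<tau> ^ j))) powr \<tau> / 2"
        using iter[of j] K wpos[of "Suc (a + j)"] \<tau> by (intro divide_right_mono powr_mono2) auto
      also have "\<dots> = 2 powr (- (\<tau> ^ Suc j)) / 2" by (simp add: powr_powr mult.commute)
      finally have "2 powr (\<tau> ^ Suc j) \<le> Z"
        using \<omega>(1) by (simp add: Z_def powr_minus field_simps)
      then have "ln (2 powr (\<tau> ^ Suc j)) \<le> ln Z" by (subst ln_le_cancel_iff) (auto simp: Z_def \<omega>(1))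
      then have "\<tau> ^ Suc j * ln 2 \<le> ln Z" by (simp add: ln_powr)
      then have "real (Suc j) * ln \<tau> \<le> 1 + lnln Z" using \<tau> by (intro exponent_le_lnln) auto
      then have "real (Suc j) \<le> B" using \<rho> by (simp add: B_def pos_le_divide_eq)
      then show ?thesis by (simp add: K)
    qed (use B in simp)
    have "A \<subseteq> {a..<K}" using min by (auto simp: A_def)
    then have "card A \<le> card {a..<K}" by (intro card_mono) auto
    then show ?thesis using bound by simp
  qed (use B in simp)
  show ?thesis
    using geo card sum_max_one_le[of K "\<lambda>k. w k powr \<eta>"] unfolding b_def B_def A_def Z_def by simp
qed

section \<open>The method up to termination\<close>

text \<open>The sequences are constrained only until the stopping test succeeds, so every estimate
  is stated for \<open>k < K\<close>, with \<open>K\<close> the first index at which it does.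
  Repeated halving shows that such an index exists.\<close>

lemma restarted_ar_trace:
  fixes f :: "'a::euclidean_space \<Rightarrow> ereal"
  assumes p: "1 \<le> p" and q: "1 < q" and \<sigma>: "0 < \<sigma>" and L: "0 < L" and \<epsilon>: "0 < \<epsilon>"
    and min: "\<And>y. f xstar \<le> f y" "f xstar \<noteq> -\<infinity>" and uc: "uniformly_convex q \<sigma> f"
    and start: "\<nu> 0 \<in> subdifferential f (x 0)" "\<epsilon> \<le> norm (\<nu> 0)"
    and run: "restarted_ar p q L \<sigma> cA CA cb f xstar \<epsilon> x \<nu> T"
  obtains K where "1 \<le> K" and "\<forall>j\<in>{1..<K}. \<epsilon> < norm (\<nu> j)" and "norm (\<nu> K) \<le> \<epsilon>"
    and "\<nu> K \<in> subdifferential f (x K)"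
    and "\<And>k. k < K \<Longrightarrow> \<epsilon> \<le> norm (\<nu> k)"
    and "\<And>k. k < K \<Longrightarrow> real (T (Suc k)) \<le> cb * restart_length p q L \<sigma> (norm (\<nu> k))"
    and "\<And>k. k < K \<Longrightarrow> norm (\<nu> (Suc k)) \<le> norm (\<nu> k) / 2"
    and "\<And>k. k < K \<Longrightarrow>
      norm (\<nu> (Suc k)) \<le> L * (q * norm (\<nu> k) / (2 * \<sigma>)) powr (real p / (q - 1))"
proof -
  \<comment> \<open>This is the condition for restart \<open>Suc k\<close> to take place. It holds
    vacuously for \<open>k = 0\<close>, since \<open>\<nu> 0\<close> is not tested; hence
    \<open>1 \<le> K\<close> even if \<open>norm (\<nu> 0) = \<epsilon>\<close>.\<close>
  define running where "running k \<longleftrightarrow> (\<forall>j\<in>{1..k}. \<epsilon> < norm (\<nu> j))" for k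
  have ar: "ar_run p L cA CA cb f xstar (restart_length p q L \<sigma> (norm (\<nu> k)))
      (x k) (x (Suc k)) (\<nu> (Suc k)) (T (Suc k))" if "running k" for k
  proof -
    have "\<forall>j\<in>{1..<Suc k}. \<epsilon> < norm (\<nu> j)" using that by (auto simp: running_def)
    then show ?thesis using run[unfolded restarted_ar_def, rule_format, of "Suc k"] by simp
  qed
  have sub: "\<nu> k \<in> subdifferential f (x k)" if "\<And>j. j < k \<Longrightarrow> running j" for k
    using start(1) ar[OF that] by (cases k) (auto simp: ar_run_def)
  have mono: "running j" if "running k" "j \<le> k" for j k
    using that by (auto simp: running_def)
  have large: "\<epsilon> \<le> norm (\<nu> k)" if "running k" for k
    using that start(2) by (cases k) (auto simp: running_def less_imp_le)
  have step: "norm (\<nu> (Suc k)) \<le> L * (q * norm (\<nu> k) / (2 * \<sigma>)) powr (real p / (q - 1))"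
      "norm (\<nu> (Suc k)) \<le> norm (\<nu> k) / 2" if k: "running k" for k
  proof -
    have "\<nu> k \<in> subdifferential f (x k)" using mono[OF k] by (intro sub) simp
    then have d: "2 * \<sigma> / q * norm (x k - xstar) powr (q - 1) \<le> norm (\<nu> k)"
      by (rule uniformly_convex_subgradient_growth[OF uc min])
    have r: "norm (\<nu> (Suc k)) \<le> restart_length p q L \<sigma> (norm (\<nu> k)) powr (- (3 * real p + 1) / 2)
        * L * norm (x k - xstar) ^ p"
      using ar[OF k] by (simp add: ar_run_def)
    have pos: "0 < norm (\<nu> k)" using large[OF k] \<epsilon> by linarith
    note * = restart_contraction[OF norm_ge_zero q \<sigma> L pos p d r]
    show "norm (\<nu> (Suc k)) \<le> L * (q * norm (\<nu> k) / (2 * \<sigma>)) powr (real p / (q - 1))"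
      "norm (\<nu> (Suc k)) \<le> norm (\<nu> k) / 2" by (rule *)+
  qed
  have "\<exists>k. \<not> running k"
  proof (rule ccontr)
    assume "\<nexists>k. \<not> running k"
    then have r: "running k" for k by blast
    obtain n where n: "norm (\<nu> 0) / \<epsilon> < 2 ^ n" using real_arch_pow[of 2 "norm (\<nu> 0) / \<epsilon>"] by auto
    have "norm (\<nu> n) \<le> norm (\<nu> 0) / 2 ^ (n - 0)"
      by (rule geometric_decay[of "Suc n"]) (use step(2) r in auto)
    moreover have "\<epsilon> \<le> norm (\<nu> n)" using large r .
    ultimately have "\<epsilon> \<le> norm (\<nu> 0) / 2 ^ n" by simp
    then show False using n \<epsilon> by (simp add: field_simps)
  qed
  define K where "K = (LEAST k. \<not> running k)"
  have K: "\<not> running K" unfolding K_def by (rule LeastI_ex) fact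
  have below: "running k" if "k < K" for k using that not_less_Least unfolding K_def by blast
  have K1: "1 \<le> K" using K by (cases K) (auto simp: running_def)
  have before: "\<forall>j\<in>{1..<K}. \<epsilon> < norm (\<nu> j)"
    using below by (force simp: running_def)
  show ?thesis
  proof (rule that[OF K1 before])
    show "norm (\<nu> K) \<le> \<epsilon>"
    proof (rule ccontr)
      assume "\<not> norm (\<nu> K) \<le> \<epsilon>"
      with before have "running K" unfolding running_def by (metis atLeastAtMost_iff
          atLeastLessThan_iff le_neq_implies_less not_le)
      with K show False by simp
    qed
    show "\<nu> K \<in> subdifferential f (x K)" using below by (rule sub)
    show "real (T (Suc k)) \<le> cb * restart_length p q L \<sigma> (norm (\<nu> k))" if "k < K" for k
      using ar[OF below[OF that]] by (simp add: ar_run_def)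
  qed (use below large step in auto)
qed

section \<open>Bounds on the number of oracle calls\<close>

text \<open>Only \<open>K - 1\<close> halvings fit between \<open>r 0\<close> and \<epsilon>. As
  \<open>ln 2\<close> is at least 2/3, they cost 3/2 of the logarithm; the maximum with 1 pays for
  the remaining restart, and 5/2 is rounded up to 3.\<close>

lemma calls_bound_critical:
  fixes r :: "nat \<Rightarrow> real"
  assumes "0 < \<epsilon>" "1 \<le> K" and low: "\<And>k. k < K \<Longrightarrow> \<epsilon> \<le> r k"
    and half: "\<And>k. Suc k < K \<Longrightarrow> r (Suc k) \<le> r k / 2"
  shows "real K \<le> 3 * max 1 (ln (r 0 / \<epsilon>))"
proof -
  have "\<epsilon> \<le> r 0 / 2 ^ (K - 1)"
    using low[of "K - 1"] geometric_decay[of K r 0 "K - 1"] half assms(2) by force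
  then have "2 ^ (K - 1) \<le> r 0 / \<epsilon>" using assms(1) by (simp add: field_simps)
  moreover have "0 < r 0 / \<epsilon>" using low[of 0] assms(1,2) by (intro divide_pos_pos) auto
  ultimately have "ln (2 ^ (K - 1)) \<le> ln (r 0 / \<epsilon>)" by (subst ln_le_cancel_iff) auto
  then have "real (K - 1) * ln 2 \<le> ln (r 0 / \<epsilon>)" by (simp add: ln_realpow)
  moreover have "real (K - 1) * (2 / 3) \<le> real (K - 1) * ln 2"
    using ln2_ge_two_thirds by (intro mult_left_mono) auto
  ultimately show ?thesis using assms(2) by (simp add: of_nat_diff)
qed

text \<open>\<open>x\<close>, \<nu> and \<open>T\<close> stand for an arbitrary execution, so the
  bounds hold whatever admissible points the subroutine returns. \<open>K\<close> is the number of
  restarts performed.\<close>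

theorem proposition5p1:
  fixes p :: nat and q L \<sigma> \<epsilon> cA CA cb :: real
    and g :: "real ^ 'n \<Rightarrow> real" and h f :: "real ^ 'n \<Rightarrow> ereal"
    and xstar x0 \<nu>0 :: "real ^ 'n" and x \<nu> :: "nat \<Rightarrow> real ^ 'n" and T :: "nat \<Rightarrow> nat"
  assumes "1 \<le> p" and "2 \<le> q"
    and "0 < cA" and "0 < CA" and "0 < cb"
    and "proper_closed_convex (\<lambda>y. ereal (g y))" and "proper_closed_convex h"
    and "f = (\<lambda>y. ereal (g y) + h y)"
    and "times_cont_differentiable p g" and "0 < L"
    and "\<And>y z. multilinear_norm p (\<lambda>vs. iterated_deriv g vs y - iterated_deriv g vs z)
                  \<le> L * norm (y - z)"
    and "\<And>y. f xstar \<le> f y"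
    and "0 < \<sigma>" and "uniformly_convex q \<sigma> f"
    and "\<nu>0 \<in> subdifferential f x0" and "0 < \<epsilon>" and "\<epsilon> \<le> norm \<nu>0"
    and "x 0 = x0" and "\<nu> 0 = \<nu>0"
    and "restarted_ar p q L \<sigma> cA CA cb f xstar \<epsilon> x \<nu> T"
  shows "\<exists>K\<ge>1.
     (\<forall>j\<in>{1..<K}. \<epsilon> < norm (\<nu> j)) \<and> norm (\<nu> K) \<le> \<epsilon> \<and>
     (\<exists>\<nu>hat \<in> subdifferential f (x K). norm \<nu>hat \<le> \<epsilon>) \<and>
     (let calls = real (\<Sum>k=1..K. T k); C = cb * restart_const p q in
       (q = real p + 1 \<longrightarrow>
          calls \<le> C * (max 1 ((real (p + 1) * L / \<sigma>) powr (2 / (3 * real p + 1)))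
                       * max 1 (ln (norm \<nu>0 / \<epsilon>)))) \<and>
       (q > real p + 1 \<longrightarrow>
          calls \<le> C * (max 1 ((q * L / \<sigma>) powr (2 / (3 * real p + 1))
                         * (\<sigma> / q) powr (2 * (q - 1 - real p) / ((3 * real p + 1) * (q - 1)))
                         * (1 / \<epsilon>) powr (2 * (q - 1 - real p) / ((3 * real p + 1) * (q - 1))))
                       + 1 / ln ((q - 1) / real p)
                         * lnln (q * norm \<nu>0 / \<sigma> * (\<sigma> / (q * L)) powr ((q - 1) / (q - 1 - real p))))) \<and>
       (q > real p + 1 \<and> \<sigma> \<le> q \<longrightarrow>
          calls \<le> C * (max 1 ((q * L / \<sigma>) powr (2 / (3 * real p + 1))
                         * (q / \<sigma>) powr (2 * (q - 1 - real p) / ((3 * real p + 1) * (q - 1)))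
                         * (1 / \<epsilon>) powr (2 * (q - 1 - real p) / ((3 * real p + 1) * (q - 1))))
                       + 1 / ln ((q - 1) / real p)
                         * lnln (q * norm \<nu>0 / \<sigma> * (\<sigma> / (q * L)) powr ((q - 1) / (q - 1 - real p))))) \<and>
       (q < real p + 1 \<longrightarrow>
          calls \<le> C * (1 / ln (real p / (q - 1))
                         * lnln (\<sigma> / (q * \<epsilon>) * (\<sigma> / (q * L)) powr ((q - 1) / (real p + 1 - q)))
                       + (q * L / \<sigma>) powr (2 / (3 * real p + 1))
                         * (q * norm \<nu>0 / \<sigma>) powr (2 * (real p - q + 1) / ((3 * real p + 1) * (q - 1))))))"
proof -
  define C where "C = cb * restart_const p q"
  define r where "r k = norm (\<nu> k)" for k
  define \<tau> where "\<tau> = real p / (q - 1)"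
  have p: "1 \<le> p" and q: "1 < q" and \<sigma>: "0 < \<sigma>" and L: "0 < L" and \<epsilon>: "0 < \<epsilon>" and cb: "0 < cb"
    using assms by auto
  have \<tau>: "0 < \<tau>" using p q by (simp add: \<tau>_def)
  have "f xstar \<noteq> -\<infinity>"
    using assms(7,8) by (cases "h xstar") (auto simp: proper_closed_convex_def)
  moreover have "\<nu> 0 \<in> subdifferential f (x 0)" "\<epsilon> \<le> norm (\<nu> 0)" using assms by auto
  ultimately obtain K where K: "1 \<le> K" and before: "\<forall>j\<in>{1..<K}. \<epsilon> < norm (\<nu> j)"
    and last: "norm (\<nu> K) \<le> \<epsilon>" "\<nu> K \<in> subdifferential f (x K)"
    and low: "\<And>k. k < K \<Longrightarrow> \<epsilon> \<le> r k"
    and T: "\<And>k. k < K \<Longrightarrow> real (T (Suc k)) \<le> cb * restart_length p q L \<sigma> (r k)"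
    and half: "\<And>k. k < K \<Longrightarrow> r (Suc k) \<le> r k / 2"
    and pow: "\<And>k. k < K \<Longrightarrow> r (Suc k) \<le> L * (q * r k / (2 * \<sigma>)) powr (real p / (q - 1))"
    unfolding r_def
    using restarted_ar_trace[OF p q \<sigma> L \<epsilon> assms(12) _ assms(14) _ _ assms(20)] by metis
  define calls where "calls = real (\<Sum>k=1..K. T k)"
  have rpos: "0 < r k" if "k < K" for k using low[OF that] \<epsilon> by simp
  have r0: "r 0 = norm \<nu>0" "\<epsilon> \<le> r 0" using assms by (auto simp: r_def)
  have "calls = (\<Sum>k<K. real (T (Suc k)))"
    unfolding calls_def by (simp add: sum.atLeast1_atMost_eq)
  also have "\<dots> \<le> (\<Sum>k<K. cb * restart_length p q L \<sigma> (r k))" by (intro sum_mono T) simp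
  finally have calls: "calls \<le> cb * (\<Sum>k<K. restart_length p q L \<sigma> (r k))"
    by (simp add: sum_distrib_left)

  have critical: "calls \<le> C * (max 1 ((real (p + 1) * L / \<sigma>) powr (2 / (3 * real p + 1)))
      * max 1 (ln (norm \<nu>0 / \<epsilon>)))" if eq: "q = real p + 1"
  proof -
    define A where "A = max 1 ((real (p + 1) * L / \<sigma>) powr (2 / (3 * real p + 1)))"
    \<comment> \<open>The exponent of the factor containing \<open>r k\<close> vanishes and its base
      is positive, so all restarts have the same length and only their number matters.\<close>
    have "restart_length p q L \<sigma> (r k) = A" if "k < K" for k
      using rpos[OF that] q \<sigma> by (simp add: restart_length_def A_def eq max.commute add.commute)
    then have "calls \<le> cb * (real K * A)" using calls by simp
    also have "\<dots> \<le> cb * (3 * max 1 (ln (r 0 / \<epsilon>)) * A)"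
      using cb K low half \<epsilon> by (intro mult_left_mono mult_right_mono calls_bound_critical)
        (auto simp: A_def)
    finally show ?thesis by (simp add: C_def restart_const_def eq A_def r0 mult_ac)
  qed

  \<comment> \<open>The absolute values let \<eta> and \<rho> serve both signs of
    \<open>p + 1 - q\<close>, as in \<open>restart_const\<close>.\<close>
  define \<eta> where "\<eta> = 2 * \<bar>real p - q + 1\<bar> / ((3 * real p + 1) * (q - 1))"
  define \<rho> where "\<rho> = \<bar>ln (real p / (q - 1))\<bar>"
  define G where "G = 1 / (1 - 2 powr (- \<eta>))"
  define \<kappa> where "\<kappa> = q / (2 * \<sigma>) * (q * L / \<sigma>) powr ((q - 1) / (real p - q + 1))"
  define w where "w k = \<kappa> * r k" for k
  have \<kappa>: "0 < \<kappa>" using q \<sigma> L by (simp add: \<kappa>_def)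
  have w_low: "\<kappa> * \<epsilon> \<le> w k" if "k < K" for k using low[OF that] \<kappa> by (simp add: w_def)
  have w_half: "w (Suc k) \<le> w k / 2" if "Suc k < K" for k
  proof -
    have "\<kappa> * r (Suc k) \<le> \<kappa> * (r k / 2)" using half[of k] that \<kappa> by (intro mult_left_mono) auto
    then show ?thesis by (simp add: w_def)
  qed
  have w_pow: "w (Suc k) \<le> w k powr \<tau> / 2" if "Suc k < K" "q \<noteq> real p + 1" for k
    unfolding w_def \<kappa>_def \<tau>_def
    using pow[of k] rpos[of k] that q \<sigma> L by (intro rescaled_step) auto
  have length: "restart_length p q L \<sigma> (r k) =
      max 1 (w k powr (2 * (real p - q + 1) / ((3 * real p + 1) * (q - 1))))"
    if "k < K" "q \<noteq> real p + 1" for k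
    unfolding w_def \<kappa>_def using that q by (intro restart_length_rescaled) auto
  have const: "\<eta> > 0" "\<rho> > 0" "G > 0" "restart_const p q =
      3 + 2 powr \<eta> * G + 2 * \<rho> + (2 + 1 / \<rho>) * exp (3 * \<eta>)" if "q \<noteq> real p + 1"
  proof -
    show \<eta>: "\<eta> > 0" using that q by (simp add: \<eta>_def)
    have "\<tau> \<noteq> 1" using that q by (simp add: \<tau>_def)
    then show "\<rho> > 0" using \<tau> by (simp add: \<rho>_def \<tau>_def[symmetric])
    show "G > 0" using \<eta> by (simp add: G_def powr_less_one)
    show "restart_const p q = 3 + 2 powr \<eta> * G + 2 * \<rho> + (2 + 1 / \<rho>) * exp (3 * \<eta>)"
      using that by (simp add: restart_const_def Let_def \<eta>_def \<rho>_def G_def)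
  qed

  \<comment> \<open>Degree above \<open>p + 1\<close>\<close>
  have sublinear: "calls \<le> C * (max 1 ((q * L / \<sigma>) powr (2 / (3 * real p + 1))
        * (\<sigma> / q) powr (2 * (q - 1 - real p) / ((3 * real p + 1) * (q - 1)))
        * (1 / \<epsilon>) powr (2 * (q - 1 - real p) / ((3 * real p + 1) * (q - 1))))
      + 1 / ln ((q - 1) / real p)
        * lnln (q * norm \<nu>0 / \<sigma> * (\<sigma> / (q * L)) powr ((q - 1) / (q - 1 - real p))))"
    (is "_ \<le> C * (max 1 ?X + 1 / _ * lnln ?W)") if gt: "q > real p + 1"
  proof -
    have ne: "q \<noteq> real p + 1" using gt by simp
    note c = const[OF ne]
    have \<eta>: "\<eta> = 2 * (q - 1 - real p) / ((3 * real p + 1) * (q - 1))"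
      using gt by (simp add: \<eta>_def abs_if algebra_simps)
    have e: "2 * (real p - q + 1) / ((3 * real p + 1) * (q - 1)) = - \<eta>"
      unfolding \<eta> minus_divide_left by (simp add: algebra_simps)
    have \<tau>1: "\<tau> < 1" using gt q by (simp add: \<tau>_def)
    have \<rho>: "ln ((q - 1) / real p) = \<rho>"
      using \<tau> \<tau>1 q p by (simp add: \<rho>_def \<tau>_def ln_div abs_if)
    have W: "2 * w 0 = ?W"
    proof -
      have i: "(q - 1) / (real p - q + 1) = - ((q - 1) / (q - 1 - real p))"
        using gt by (simp add: divide_simps) (simp add: algebra_simps)
      have "(\<sigma> / (q * L)) = inverse (q * L / \<sigma>)" by simp
      then have "(q * L / \<sigma>) powr ((q - 1) / (real p - q + 1))
          = (\<sigma> / (q * L)) powr ((q - 1) / (q - 1 - real p))"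
        unfolding i powr_minus by (simp add: powr_divide powr_mult inverse_eq_divide)
      then show ?thesis using \<sigma> by (simp add: w_def \<kappa>_def r0)
    qed
    \<comment> \<open>The factor \<open>2 powr \<eta>\<close> in \<open>restart_const\<close>
      originates here, from the 2 in the denominator of \<kappa>.\<close>
    have X: "(\<kappa> * \<epsilon>) powr (- \<eta>) = 2 powr \<eta> * ?X"
    proof -
      have "(q * \<epsilon> / (2 * \<sigma>)) powr (- \<eta>) = inverse (q * \<epsilon> / (2 * \<sigma>)) powr \<eta>"
        using q \<sigma> \<epsilon> by (simp add: powr_minus_divide powr_divide)
      also have "inverse (q * \<epsilon> / (2 * \<sigma>)) = 2 * (\<sigma> / q) * (1 / \<epsilon>)" by simp
      also have "\<dots> powr \<eta> = 2 powr \<eta> * (\<sigma> / q) powr \<eta> * (1 / \<epsilon>) powr \<eta>"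
        using q \<sigma> \<epsilon> by (simp only: powr_mult)
      finally show ?thesis
        using rescaled_powr[OF q ne, of \<sigma> L \<epsilon>] unfolding e \<kappa>_def[symmetric] \<eta>[symmetric]
        by (simp only: mult_ac)
    qed
    have "(\<Sum>k<K. restart_length p q L \<sigma> (r k)) = (\<Sum>k<K. max 1 (w k powr (- \<eta>)))"
      using length[OF _ ne] unfolding e by simp
    also have "\<dots> \<le> (\<kappa> * \<epsilon>) powr (- \<eta>) / (1 - 2 powr (- \<eta>)) + 1 + (1 + lnln (2 * w 0)) / ln (1 / \<tau>)"
      using \<tau> \<tau>1 c(1) \<kappa> \<epsilon> w_low w_half w_pow ne by (intro sum_restart_lengths_sublinear) auto
    also have "\<dots> = (2 powr \<eta> * G) * ?X + (1 + 1 / \<rho>) + 1 / \<rho> * lnln ?W"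
      unfolding X W using \<rho> by (simp add: G_def \<tau>_def add_divide_distrib)
    \<comment> \<open>The additive constant \<open>1 + 1 / \<rho>\<close> is absorbed by
      \<open>max 1 ?X\<close>.\<close>
    also have "\<dots> \<le> (2 powr \<eta> * G) * max 1 ?X + (2 + 1 / \<rho>) * max 1 ?X + 1 / \<rho> * lnln ?W"
    proof -
      have "(2 powr \<eta> * G) * ?X \<le> (2 powr \<eta> * G) * max 1 ?X"
        using c by (intro mult_left_mono) auto
      moreover have "(2 + 1 / \<rho>) * 1 \<le> (2 + 1 / \<rho>) * max 1 ?X"
        using c by (intro mult_left_mono) auto
      then have "1 + 1 / \<rho> \<le> (2 + 1 / \<rho>) * max 1 ?X" by (rule order_trans[rotated]) simp
      ultimately show ?thesis by (intro add_mono order_refl)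
    qed
    also have "\<dots> \<le> restart_const p q * (max 1 ?X + 1 / \<rho> * lnln ?W)"
    proof -
      \<comment> \<open>The factor \<open>exp (3 * \<eta>)\<close> is dictated by the case
        \<open>q < p + 1\<close>; here it suffices that it is at least 1.\<close>
      have "(2 + 1 / \<rho>) * 1 \<le> (2 + 1 / \<rho>) * exp (3 * \<eta>)"
        using c by (intro mult_left_mono) auto
      moreover have "0 \<le> 2 powr \<eta> * G" using c by simp
      ultimately have R: "2 powr \<eta> * G + (2 + 1 / \<rho>) \<le> restart_const p q" "1 \<le> restart_const p q"
        unfolding c(4) using c(2) by auto
      have l: "0 \<le> 1 / \<rho> * lnln ?W" using c(2) lnln_nonneg[of ?W] by simp
      have "(2 powr \<eta> * G + (2 + 1 / \<rho>)) * max 1 ?X \<le> restart_const p q * max 1 ?X"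
        using R by (intro mult_right_mono) auto
      moreover have "1 * (1 / \<rho> * lnln ?W) \<le> restart_const p q * (1 / \<rho> * lnln ?W)"
        using R l by (intro mult_right_mono) auto
      ultimately show ?thesis by (simp add: distrib_left distrib_right)
    qed
    finally have "cb * (\<Sum>k<K. restart_length p q L \<sigma> (r k)) \<le>
        cb * (restart_const p q * (max 1 ?X + 1 / \<rho> * lnln ?W))"
      using cb by (intro mult_left_mono) auto
    then show ?thesis using calls unfolding \<rho> C_def by (simp add: mult.assoc)
  qed

  have sublinear': "calls \<le> C * (max 1 ((q * L / \<sigma>) powr (2 / (3 * real p + 1))
        * (q / \<sigma>) powr (2 * (q - 1 - real p) / ((3 * real p + 1) * (q - 1)))
        * (1 / \<epsilon>) powr (2 * (q - 1 - real p) / ((3 * real p + 1) * (q - 1))))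
      + 1 / ln ((q - 1) / real p)
        * lnln (q * norm \<nu>0 / \<sigma> * (\<sigma> / (q * L)) powr ((q - 1) / (q - 1 - real p))))"
    if gt: "q > real p + 1 \<and> \<sigma> \<le> q"
  proof -
    have ne: "q \<noteq> real p + 1" using gt by simp
    note c = const[OF ne]
    have "0 \<le> 2 * (q - 1 - real p) / ((3 * real p + 1) * (q - 1))" using gt q by simp
    moreover have "\<sigma> / q \<le> 1" "1 \<le> q / \<sigma>" using gt q \<sigma> by auto
    then have "\<sigma> / q \<le> q / \<sigma>" by linarith
    ultimately have le: "(\<sigma> / q) powr (2 * (q - 1 - real p) / ((3 * real p + 1) * (q - 1))) \<le>
        (q / \<sigma>) powr (2 * (q - 1 - real p) / ((3 * real p + 1) * (q - 1)))"
      using q \<sigma> by (intro powr_mono2) auto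
    have "0 \<le> C" using c cb by (simp add: C_def)
    then show ?thesis
      by (intro order_trans[OF sublinear[OF conjunct1[OF gt]]] mult_left_mono add_right_mono
          max.mono mult_right_mono le) auto
  qed

  \<comment> \<open>Degree below \<open>p + 1\<close>\<close>
  have superlinear: "calls \<le> C * (1 / ln (real p / (q - 1))
        * lnln (\<sigma> / (q * \<epsilon>) * (\<sigma> / (q * L)) powr ((q - 1) / (real p + 1 - q)))
      + (q * L / \<sigma>) powr (2 / (3 * real p + 1))
        * (q * norm \<nu>0 / \<sigma>) powr (2 * (real p - q + 1) / ((3 * real p + 1) * (q - 1))))"
    (is "_ \<le> C * (1 / _ * lnln ?Z + ?Y)") if lt: "q < real p + 1"
  proof -
    have ne: "q \<noteq> real p + 1" using lt by simp
    note c = const[OF ne]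
    have e: "2 * (real p - q + 1) / ((3 * real p + 1) * (q - 1)) = \<eta>"
      using lt by (simp add: \<eta>_def)
    have \<tau>1: "1 < \<tau>" using lt q by (simp add: \<tau>_def)
    then have \<rho>: "ln \<tau> = \<rho>" "ln (real p / (q - 1)) = \<rho>" by (simp_all add: \<rho>_def \<tau>_def)
    have Z: "1 / (2 * (\<kappa> * \<epsilon>)) = ?Z"
    proof -
      have swap: "real p + 1 - q = real p - q + 1" by simp
      show ?thesis unfolding swap
        by (simp add: \<kappa>_def powr_divide powr_mult)
    qed
    have Y: "2 powr \<eta> * w 0 powr \<eta> = ?Y"
    proof -
      have "2 powr \<eta> * (q * r 0 / (2 * \<sigma>)) powr \<eta> = (2 * (q * r 0 / (2 * \<sigma>))) powr \<eta>"
        by (rule powr_mult[symmetric])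
      also have "\<dots> = (q * norm \<nu>0 / \<sigma>) powr \<eta>" by (simp add: r0)
      finally show ?thesis
        using rescaled_powr[OF q ne, of \<sigma> L "r 0"] unfolding e \<kappa>_def[symmetric] w_def
        by (simp add: mult.left_commute)
    qed
    have Yge: "?Z powr (- \<eta>) \<le> ?Y"
    proof -
      have "?Z powr (- \<eta>) = (2 * (\<kappa> * \<epsilon>)) powr \<eta>"
        unfolding Z[symmetric] by (simp only: powr_minus_divide powr_divide) simp
      also have "\<dots> \<le> (2 * w 0) powr \<eta>"
        using w_low[of 0] K \<kappa> \<epsilon> c(1) by (intro powr_mono2) auto
      finally show ?thesis unfolding Y[symmetric] powr_mult .
    qed
    have Zpos: "0 < ?Z" unfolding Z[symmetric] using \<kappa> \<epsilon> by simp
    have l: "0 \<le> lnln ?Z" by (rule lnln_nonneg)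
    have Y0: "0 \<le> ?Y" by simp
    have "w 0 powr \<eta> / (1 - 2 powr (- \<eta>)) \<le> 2 powr \<eta> * G * ?Y"
    proof -
      \<comment> \<open>Already \<open>w 0 powr \<eta> \<le> ?Y\<close>; the extra
        \<open>2 powr \<eta>\<close> matches the constant shared with
        \<open>q > p + 1\<close>.\<close>
      have "w 0 powr \<eta> \<le> 2 powr \<eta> * (2 powr \<eta> * w 0 powr \<eta>)"
        using c(1) ge_one_powr_ge_zero[of 2 \<eta>] by (smt (verit) mult_le_cancel_right1 mult_nonneg_nonneg powr_ge_zero)
      then have "w 0 powr \<eta> * G \<le> 2 powr \<eta> * (2 powr \<eta> * w 0 powr \<eta>) * G"
        using c by (intro mult_right_mono) auto
      then show ?thesis unfolding Y[symmetric] by (simp add: G_def mult_ac)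
    qed
    text \<open>
      The bound has no additive constant, but \<open>?Y\<close> and \<open>lnln ?Z\<close> cannot both be small, because
      \<open>\<epsilon> \<le> r 0\<close> gives \<open>?Z\<^sup>-\<^sup>\<eta> \<le> ?Y\<close>.
    \<close>
    moreover have "2 + 1 / \<rho> \<le> (3 + 2 * \<rho>) * (1 / \<rho> * lnln ?Z) + (2 + 1 / \<rho>) * exp (3 * \<eta>) * ?Y"
    proof (cases "ln ?Z \<le> 3")
      case True
      \<comment> \<open>For small \<open>?Z\<close> the term \<open>?Y\<close> is at least
        \<open>exp (- (3 * \<eta>))\<close>, which explains \<open>exp (3 * \<eta>)\<close> in
        \<open>restart_const\<close>.\<close>
      then have "3 * - \<eta> \<le> ln ?Z * - \<eta>" using c(1) by (intro mult_right_mono_neg) auto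
      then have "exp (- (3 * \<eta>)) \<le> exp (- \<eta> * ln ?Z)" by (simp add: mult.commute)
      also have "\<dots> = ?Z powr (- \<eta>)" using less_imp_neq[OF Zpos, symmetric] by (simp only: powr_def[of "?Z"] if_False)
      finally have "exp (- (3 * \<eta>)) \<le> ?Y" using Yge by linarith
      then have "exp (3 * \<eta>) * exp (- (3 * \<eta>)) \<le> exp (3 * \<eta>) * ?Y" by (intro mult_left_mono) auto
      then have "1 \<le> exp (3 * \<eta>) * ?Y" by (simp add: exp_minus)
      then have "(2 + 1 / \<rho>) * 1 \<le> (2 + 1 / \<rho>) * (exp (3 * \<eta>) * ?Y)"
        using c by (intro mult_left_mono) auto
      moreover have "0 \<le> (3 + 2 * \<rho>) * (1 / \<rho> * lnln ?Z)" using c l by simp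
      ultimately show ?thesis by (simp add: mult.assoc)
    next
      case False
      \<comment> \<open>The threshold 3 is at least \<open>exp 1\<close>, so \<open>lnln ?Z\<close>
        is at least 1, and \<open>(3 + 2 * \<rho>) / \<rho>\<close> exceeds
        \<open>2 + 1 / \<rho>\<close>.\<close>
      then have "ln (exp 1) \<le> lnln ?Z"
        unfolding lnln_def using exp_le by (subst ln_le_cancel_iff) auto
      then have "(3 + 2 * \<rho>) * (1 / \<rho> * 1) \<le> (3 + 2 * \<rho>) * (1 / \<rho> * lnln ?Z)"
        using c by (intro mult_left_mono) auto
      moreover have "2 + 1 / \<rho> \<le> (3 + 2 * \<rho>) * (1 / \<rho> * 1)" using c by (simp add: field_simps)
      moreover have "0 \<le> (2 + 1 / \<rho>) * exp (3 * \<eta>) * ?Y" using c by simp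
      ultimately show ?thesis by linarith
    qed
    moreover have "1 / \<rho> * lnln ?Z + (3 + 2 * \<rho>) * (1 / \<rho> * lnln ?Z) + 2 powr \<eta> * G * ?Y
        + (2 + 1 / \<rho>) * exp (3 * \<eta>) * ?Y \<le> restart_const p q * (1 / \<rho> * lnln ?Z + ?Y)"
    proof -
      have "1 * 1 \<le> (2 + 1 / \<rho>) * exp (3 * \<eta>)" using c by (intro mult_mono) auto
      moreover have "0 \<le> 2 powr \<eta> * G" using c by simp
      ultimately have "4 + 2 * \<rho> \<le> restart_const p q" unfolding c(4) by linarith
      then have "(4 + 2 * \<rho>) * (1 / \<rho> * lnln ?Z) \<le> restart_const p q * (1 / \<rho> * lnln ?Z)"
        using c l by (intro mult_right_mono) auto
      moreover have "(2 powr \<eta> * G + (2 + 1 / \<rho>) * exp (3 * \<eta>)) * ?Y \<le> restart_const p q * ?Y"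
        unfolding c(4) using c Y0 by (intro mult_right_mono) auto
      \<comment> \<open>Stating the final regrouping for abstract reals keeps the simplifier from
        rewriting inside \<open>?Y\<close> and \<open>?Z\<close>.\<close>
      moreover have "a + (3 + 2 * \<rho>) * a + g * y + E * y \<le> R * (a + y)"
        if "(4 + 2 * \<rho>) * a \<le> R * a" "(g + E) * y \<le> R * y" for a g y E R :: real
        using that by (simp add: algebra_simps)
      ultimately show ?thesis by blast
    qed
    moreover have "(\<Sum>k<K. restart_length p q L \<sigma> (r k)) = (\<Sum>k<K. max 1 (w k powr \<eta>))"
      using length[OF _ ne] unfolding e by simp
    moreover have "(\<Sum>k<K. max 1 (w k powr \<eta>)) \<le>
        w 0 powr \<eta> / (1 - 2 powr (- \<eta>)) + 2 + (1 + lnln (1 / (2 * (\<kappa> * \<epsilon>)))) / ln \<tau>"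
      using \<tau>1 c(1) \<kappa> \<epsilon> w_low w_half w_pow ne by (intro sum_restart_lengths_superlinear) auto
    moreover have "(1 + lnln (1 / (2 * (\<kappa> * \<epsilon>)))) / ln \<tau> = 1 / \<rho> + 1 / \<rho> * lnln ?Z"
      unfolding Z \<rho> by (simp add: add_divide_distrib)
    ultimately have "(\<Sum>k<K. restart_length p q L \<sigma> (r k)) \<le>
        restart_const p q * (1 / \<rho> * lnln ?Z + ?Y)" by linarith
    then have "cb * (\<Sum>k<K. restart_length p q L \<sigma> (r k)) \<le>
        cb * (restart_const p q * (1 / \<rho> * lnln ?Z + ?Y))"
      using cb by (intro mult_left_mono) auto
    then show ?thesis using calls unfolding \<rho> C_def by (simp add: mult.assoc)
  qed

  show ?thesis
    unfolding Let_def
  proof (intro exI[of _ K] conjI)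
    show "\<exists>\<nu>hat\<in>subdifferential f (x K). norm \<nu>hat \<le> \<epsilon>" using last by blast
  qed (use K before last critical sublinear sublinear' superlinear in \<open>simp_all add: calls_def C_def\<close>)
qed

end
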